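(* Let $X$ be a complex Banach space, let $A:\operatorname{dom}(A)\subseteq X\to X$ and $B:\operatorname{dom}(B)\subseteq X\to X$ be closed linear operators with $\rho(B)\neq\emptyset$, and let $Y$ be a Banach space continuously embedded in $X$ such that $\operatorname{dom}(A)\subseteq\operatorname{dom}(B^2)\cap Y$, $B(\operatorname{dom}(A))\subseteq Y\subseteq\operatorname{dom}(B)$, and the operator $G=\begin{bmatrix}-B & I \\ A+B^2 & -B\end{bmatrix}$ with domain $\operatorname{dom}(A)\times Y$ generates a $C_0$-group $\{\mathcal T(t)\}_{t\in\mathbb R}$ on $Y\times X$. If $x\in\operatorname{dom}(A)$ and $y\in Y$, then the initial value problem $$u''(t)+2Bu'(t)=Au(t),\ t\in\mathbb R,\qquad u(0)=x,\ u'(0)=y,$$ has a unique classical solution, and it is given by $$u(t)=T_{11}(t)x+T_{12}(t)(y+Bx),\qquad t\in\mathbb R.$$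
   Context: The group is written in block form $\mathcal T(t)=\begin{bmatrix}T_{11}(t) & T_{12}(t) \\ T_{21}(t) & T_{22}(t)\end{bmatrix}$ with respect to $Y\times X$, so $T_{11}(t)\in\mathcal B(Y)$, $T_{12}(t)\in\mathcal B(X,Y)$, $T_{21}(t)\in\mathcal B(Y,X)$, $T_{22}(t)\in\mathcal B(X)$. A function $u\in\mathcal C^2(\mathbb R,X)$ is a classical solution of the initial value problem if $u(t)\in\operatorname{dom}(A)$ and $u'(t)\in\operatorname{dom}(B)$ for every $t\in\mathbb R$, $Au(\cdot)\in\mathcal C(\mathbb R,X)$, and $u$ satisfies the equation and the initial conditions. *)

theory Defs
  imports "HOL-Analysis.Analysis"
begin

section \<open>Complex Banach spaces\<close>

class complex_normed_vector = real_normed_vector +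
  fixes scaleC :: "complex \<Rightarrow> 'a \<Rightarrow> 'a" (infixr \<open>*\<^sub>C\<close> 75)
  assumes scaleC_add_right: "a *\<^sub>C (x + y) = a *\<^sub>C x + a *\<^sub>C y"
    and scaleC_add_left: "(a + b) *\<^sub>C x = a *\<^sub>C x + b *\<^sub>C x"
    and scaleC_scaleC: "a *\<^sub>C b *\<^sub>C x = (a * b) *\<^sub>C x"
    and scaleR_scaleC: "r *\<^sub>R x = complex_of_real r *\<^sub>C x"
    and norm_scaleC: "norm (a *\<^sub>C x) = cmod a * norm x"

class complex_banach = complex_normed_vector + complete_space

subclass (in complex_banach) banach ..

instantiation complex :: complex_banach
begin
definition scaleC_complex :: "complex \<Rightarrow> complex \<Rightarrow> complex"
  where "scaleC_complex a x = a * x"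
instance
  by standard (simp_all add: scaleC_complex_def algebra_simps norm_mult scaleR_conv_of_real)
end

instantiation prod :: (complex_normed_vector, complex_normed_vector) complex_normed_vector
begin
definition scaleC_prod :: "complex \<Rightarrow> 'a \<times> 'b \<Rightarrow> 'a \<times> 'b"
  where "scaleC_prod a p = (a *\<^sub>C fst p, a *\<^sub>C snd p)"
instance
proof
  fix a b :: complex and r :: real and x y :: "'a \<times> 'b"
  show "a *\<^sub>C (x + y) = a *\<^sub>C x + a *\<^sub>C y"
    by (simp add: scaleC_prod_def scaleC_add_right)
  show "(a + b) *\<^sub>C x = a *\<^sub>C x + b *\<^sub>C x"
    by (simp add: scaleC_prod_def scaleC_add_left)
  show "a *\<^sub>C b *\<^sub>C x = (a * b) *\<^sub>C x"
    by (simp add: scaleC_prod_def scaleC_scaleC)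
  show "r *\<^sub>R x = complex_of_real r *\<^sub>C x"
    by (simp add: scaleC_prod_def scaleR_prod_def scaleR_scaleC)
  have "norm (a *\<^sub>C x) = sqrt ((cmod a)\<^sup>2 * ((norm (fst x))\<^sup>2 + (norm (snd x))\<^sup>2))"
    by (simp add: norm_prod_def scaleC_prod_def norm_scaleC power_mult_distrib distrib_left)
  then show "norm (a *\<^sub>C x) = cmod a * norm x"
    by (simp add: norm_prod_def real_sqrt_mult)
qed
end

instance prod :: (complex_banach, complex_banach) complex_banach ..

section \<open>Bounded and unbounded linear operators\<close>

definition bounded_clinear ::
    "('a::complex_normed_vector \<Rightarrow> 'b::complex_normed_vector) \<Rightarrow> bool"
  where "bounded_clinear f \<longleftrightarrow> bounded_linear f \<and> (\<forall>c x. f (c *\<^sub>C x) = c *\<^sub>C f x)"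

text \<open>An operator with domain \<open>D\<close> is a pair of a set \<open>D\<close> and a total function
  whose values outside \<open>D\<close> are irrelevant.\<close>

definition linear_operator ::
    "'a::complex_normed_vector set \<Rightarrow> ('a \<Rightarrow> 'b::complex_normed_vector) \<Rightarrow> bool"
  where "linear_operator D A \<longleftrightarrow>
    0 \<in> D \<and> (\<forall>x\<in>D. \<forall>y\<in>D. x + y \<in> D) \<and> (\<forall>c. \<forall>x\<in>D. c *\<^sub>C x \<in> D) \<and>
    (\<forall>x\<in>D. \<forall>y\<in>D. A (x + y) = A x + A y) \<and> (\<forall>c. \<forall>x\<in>D. A (c *\<^sub>C x) = c *\<^sub>C A x)"

definition closed_linear_operator ::
    "'a::complex_normed_vector set \<Rightarrow> ('a \<Rightarrow> 'b::complex_normed_vector) \<Rightarrow> bool"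
  where "closed_linear_operator D A \<longleftrightarrow> linear_operator D A \<and> closed ((\<lambda>x. (x, A x)) ` D)"

definition resolvent_set ::
    "'a::complex_normed_vector set \<Rightarrow> ('a \<Rightarrow> 'a) \<Rightarrow> complex set"
  where "resolvent_set D A =
    {z. bij_betw (\<lambda>x. z *\<^sub>C x - A x) D UNIV \<and>
        bounded_clinear (inv_into D (\<lambda>x. z *\<^sub>C x - A x))}"

definition dom_square :: "'a set \<Rightarrow> ('a \<Rightarrow> 'a) \<Rightarrow> 'a set"
  where "dom_square D A = {x \<in> D. A x \<in> D}"

section \<open>Strongly continuous groups\<close>

definition C0_group :: "(real \<Rightarrow> 'a::complex_normed_vector \<Rightarrow> 'a) \<Rightarrow> bool"
  where "C0_group T \<longleftrightarrow>
    (\<forall>t. bounded_clinear (T t)) \<and> T 0 = id \<and> (\<forall>s t. T (s + t) = T s \<circ> T t) \<and>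
    (\<forall>x. continuous_on UNIV (\<lambda>t. T t x))"

definition generates_C0_group ::
    "'a::complex_normed_vector set \<Rightarrow> ('a \<Rightarrow> 'a) \<Rightarrow> (real \<Rightarrow> 'a \<Rightarrow> 'a) \<Rightarrow> bool"
  where "generates_C0_group D G T \<longleftrightarrow> C0_group T \<and>
    D = {x. \<exists>z. ((\<lambda>t. (T t x - x) /\<^sub>R t) \<longlongrightarrow> z) (at 0)} \<and>
    (\<forall>x\<in>D. ((\<lambda>t. (T t x - x) /\<^sub>R t) \<longlongrightarrow> G x) (at 0))"

definition block11 :: "('y::complex_normed_vector \<times> 'x::complex_normed_vector \<Rightarrow> 'y \<times> 'x) \<Rightarrow> 'y \<Rightarrow> 'y"
  where "block11 S y = fst (S (y, 0))"

definition block12 :: "('y::complex_normed_vector \<times> 'x::complex_normed_vector \<Rightarrow> 'y \<times> 'x) \<Rightarrow> 'x \<Rightarrow> 'y"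
  where "block12 S x = fst (S (0, x))"

section \<open>The second order problem\<close>

text \<open>The space \<open>Y\<close> is a type of its own, and its continuous embedding into \<open>X\<close>
  is an explicit map \<open>j\<close>; as a subset of \<open>X\<close>, the space \<open>Y\<close> is \<open>range j\<close>,
  and \<open>inv j\<close> regards an element of that subset as an element of \<open>Y\<close>.\<close>

definition continuous_embedding ::
    "('y::complex_normed_vector \<Rightarrow> 'x::complex_normed_vector) \<Rightarrow> bool"
  where "continuous_embedding j \<longleftrightarrow> bounded_clinear j \<and> inj j"

definition dom_G :: "('y \<Rightarrow> 'x) \<Rightarrow> 'x set \<Rightarrow> ('y \<times> 'x) set"
  where "dom_G j domA = {(v, w). j v \<in> domA \<and> w \<in> range j}"

text \<open>The first component of \<open>op_G\<close> is meaningful on \<open>dom_G\<close> only if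
  \<open>B\<close> maps \<open>domA\<close> into \<open>range j\<close>.\<close>

definition op_G ::
    "('y \<Rightarrow> 'x::complex_normed_vector) \<Rightarrow> ('x \<Rightarrow> 'x) \<Rightarrow> ('x \<Rightarrow> 'x) \<Rightarrow> 'y \<times> 'x \<Rightarrow> 'y \<times> 'x"
  where "op_G j A B = (\<lambda>(v, w).
    (inv j (- B (j v) + w), (A (j v) + B (B (j v))) - B w))"

abbreviation vderiv :: "(real \<Rightarrow> 'a::real_normed_vector) \<Rightarrow> real \<Rightarrow> 'a"
  where "vderiv u \<equiv> \<lambda>t. vector_derivative u (at t)"

definition classical_solution ::
    "'x::complex_normed_vector set \<Rightarrow> ('x \<Rightarrow> 'x) \<Rightarrow> 'x set \<Rightarrow> ('x \<Rightarrow> 'x) \<Rightarrow>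
     'x \<Rightarrow> 'x \<Rightarrow> (real \<Rightarrow> 'x) \<Rightarrow> bool"
  where "classical_solution domA A domB B x y u \<longleftrightarrow>
    (\<forall>t. u differentiable at t) \<and> vderiv u C1_differentiable_on UNIV \<and>
    (\<forall>t. u t \<in> domA \<and> vderiv u t \<in> domB) \<and>
    continuous_on UNIV (\<lambda>t. A (u t)) \<and>
    (\<forall>t. vderiv (vderiv u) t + 2 *\<^sub>R B (vderiv u t) = A (u t)) \<and>
    u 0 = x \<and> vderiv u 0 = y"

end

theory Submission imports Defs
begin

text \<open>If \<open>(v, w)\<close> is the orbit of \<open>(x, y + B x)\<close>, then \<open>v' = w - B v\<close> in \<open>Y\<close>; since \<open>B\<close> restricted to \<open>Y\<close>
  is bounded, \<open>u = v\<close> may be differentiated once more in \<open>X\<close>, and the second row of \<open>G\<close> gives the equation.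
  Conversely, let \<open>u\<close> be a solution with zero data. By the closed graph theorem \<open>u\<close> and \<open>B u\<close> are
  continuous into \<open>Y\<close>, and \<open>Z(t) = (\<integral>\<^sub>0\<^sup>t u, u(t) + \<integral>\<^sub>0\<^sup>t B u)\<close> lies in the domain of \<open>G\<close> and solves \<open>Z' = G Z\<close>,
  \<open>Z(0) = 0\<close>. Since \<open>T(t - s) Z(s)\<close> does not depend on \<open>s\<close>, \<open>Z\<close> vanishes, and so does \<open>u\<close>.\<close>

section \<open>The closed graph theorem\<close>

text \<open>The Baire half of the closed graph theorem: the closures of the sublevel sets of
  \<open>norm (f x)\<close> cover the complete space \<open>S\<close>, so one of them has interior
  in \<open>S\<close>. Linearity moves that interior point to the origin. The bound holds only for
  points \<open>y\<close> near \<open>x\<close>, since closures were taken. A subspace is allowed in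
  place of the whole type so that \<open>S\<close> can be the graph of a closed operator.\<close>

lemma approx_bound_of_subspace_Baire:
  fixes f :: "'a::banach \<Rightarrow> 'b::real_normed_vector"
  assumes S: "subspace S" "closed S"
    and add: "\<And>x y. x \<in> S \<Longrightarrow> y \<in> S \<Longrightarrow> f (x + y) = f x + f y"
    and scale: "\<And>c x. x \<in> S \<Longrightarrow> f (c *\<^sub>R x) = c *\<^sub>R f x"
  obtains M where "M \<ge> 0"
    and "\<And>x e. x \<in> S \<Longrightarrow> e > 0 \<Longrightarrow> \<exists>y\<in>S. norm (x - y) < e \<and> norm (f y) \<le> M * norm x"
proof -
  have diff: "f (x - y) = f x - f y" if "x \<in> S" "y \<in> S" for x y
    using add[of x "(- 1) *\<^sub>R y"] scale[of y "- 1"] that subspace_scale[OF S(1), of y "-1"] by simp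
  define C where "C n = S \<inter> closure {x \<in> S. norm (f x) \<le> real n}" for n :: nat
  have Ceq: "C n = closure {x \<in> S. norm (f x) \<le> real n}" for n
    unfolding C_def using closure_minimal[of "{x \<in> S. norm (f x) \<le> real n}" S] S(2) by auto
  have "\<exists>n. top_of_set S interior_of C n \<noteq> {}"
  \<comment> \<open>Baire is applied in the subspace topology of \<open>S\<close>: otherwise the
    union of the \<open>C n\<close>, which is all of \<open>S\<close> and contains \<open>0\<close>,
    would have empty interior there.\<close>
  proof (rule ccontr)
    assume "\<not> ?thesis"
    then have "top_of_set S interior_of \<Union>(range C) = {}"
      by (intro Baire_category_alt)
        (auto simp: C_def S(2) completely_metrizable_space_closedin completely_metrizable_space_euclidean
           intro: closedin_closed_Int)
    moreover have "\<Union>(range C) = S"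
    proof -
      have "x \<in> C (nat \<lceil>norm (f x)\<rceil>)" if "x \<in> S" for x
        unfolding C_def using that by (intro IntI subsetD[OF closure_subset]) auto
      then show ?thesis unfolding C_def by blast
    qed
    moreover have "0 \<in> S" using S(1) by (rule subspace_0)
    ultimately show False by simp (metis empty_iff interior_of_topspace topspace_euclidean_subtopology)
  qed
  then obtain n x0 where "x0 \<in> top_of_set S interior_of C n" by blast
  then obtain U where U: "openin (top_of_set S) U" "x0 \<in> U" "U \<subseteq> C n"
    by (auto simp: interior_of_def)
  then obtain r where r: "r > 0" "ball x0 r \<inter> S \<subseteq> C n"
    by (meson openin_contains_ball order_trans)
  have x0: "x0 \<in> S" "x0 \<in> C n" using U openin_imp_subset by blast+
  \<comment> \<open>Both \<open>x0 + x\<close> and \<open>x0\<close> are approximated from the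
    sublevel set; the difference of the approximants is close to \<open>x\<close>, and the two
    bounds add up to \<open>2 * real n\<close>.\<close>
  have near: "\<exists>y\<in>S. norm (x - y) < e \<and> norm (f y) \<le> 2 * real n" if x: "x \<in> S" "norm x < r" and e: "e > 0" for x e
  proof -
    have "x0 + x \<in> C n"
      using x x0 r subspace_add[OF S(1)] by (intro subsetD[OF r(2)]) (auto simp: dist_norm)
    then obtain p where p: "p \<in> S" "norm (f p) \<le> n" "dist p (x0 + x) < e/2"
      unfolding C_def using e by (auto simp: closure_approachable dest!: spec[of _ "e/2"])
    obtain q where q: "q \<in> S" "norm (f q) \<le> n" "dist q x0 < e/2"
      using x0(2) unfolding C_def using e by (auto simp: closure_approachable dest!: spec[of _ "e/2"])
    have "norm (x - (p - q)) = norm ((q - x0) - (p - (x0 + x)))" by (simp add: algebra_simps)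
    also have "\<dots> < e" using p(3) q(3) norm_triangle_ineq4[of "q - x0" "p - (x0 + x)"] by (simp add: dist_norm)
    finally have "norm (x - (p - q)) < e" .
    moreover have "norm (f (p - q)) \<le> 2 * real n"
      using diff[OF p(1) q(1)] norm_triangle_ineq4[of "f p" "f q"] p(2) q(2) by simp
    ultimately show ?thesis using p(1) q(1) S(1) subspace_diff by blast
  qed
  show ?thesis
  proof
    show "0 \<le> 4 * real n / r" using r by simp
    fix x and e :: real assume x: "x \<in> S" and e: "e > 0"
    show "\<exists>y\<in>S. norm (x - y) < e \<and> norm (f y) \<le> 4 * real n / r * norm x"
    proof (cases "x = 0")
      case True
      then show ?thesis using e x scale[OF x, of 0] by (intro bexI[of _ 0]) auto
    next
      case False
      \<comment> \<open>This factor puts \<open>c *\<^sub>R x\<close> at radius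
        \<open>r / 2\<close>; dividing \<open>2 * real n\<close> by it gives the constant
        \<open>4 * real n / r\<close>.\<close>
      define c where "c = r / (2 * norm x)"
      have c: "c > 0" using r False by (simp add: c_def)
      have "norm (c *\<^sub>R x) < r" using r False by (simp add: c_def)
      then obtain y where y: "y \<in> S" "norm (c *\<^sub>R x - y) < c * e" "norm (f y) \<le> 2 * real n"
        using near[of "c *\<^sub>R x" "c * e"] subspace_scale[OF S(1) x] c e by auto
      have "norm (x - y /\<^sub>R c) = norm (c *\<^sub>R x - y) / c"
      proof -
        have "x - y /\<^sub>R c = (c *\<^sub>R x - y) /\<^sub>R c" using c by (simp add: scaleR_diff_right)
        then show ?thesis using c by (simp add: divide_inverse mult.commute)
      qed
      also have "\<dots> < e" using y(2) c by (simp add: field_simps)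
      finally have "norm (x - y /\<^sub>R c) < e" .
      moreover have "norm (f (y /\<^sub>R c)) \<le> 4 * real n / r * norm x"
      proof -
        have "norm (f (y /\<^sub>R c)) = norm (f y) / c" using scale[OF y(1)] c by (simp add: divide_inverse mult.commute)
        also have "\<dots> \<le> 2 * real n / c" using y(3) c by (simp add: divide_right_mono)
        also have "\<dots> = 4 * real n / r * norm x" using r False by (simp add: c_def field_simps)
        finally show ?thesis .
      qed
      ultimately show ?thesis using subspace_scale[OF S(1) y(1)] by blast
    qed
  qed
qed

text \<open>Successive approximation: \<open>x\<close> is exhausted by approximants whose residuals
  shrink geometrically, so their images under \<open>f\<close> form an absolutely convergent series
  bounded by \<open>2 * M * norm x\<close>. Closedness of the graph identifies its sum with
  \<open>f x\<close>.\<close>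

theorem closed_graph:
  fixes f :: "'a::banach \<Rightarrow> 'b::banach"
  assumes S: "subspace S" "closed S"
    and add: "\<And>x y. x \<in> S \<Longrightarrow> y \<in> S \<Longrightarrow> f (x + y) = f x + f y"
    and scale: "\<And>c x. x \<in> S \<Longrightarrow> f (c *\<^sub>R x) = c *\<^sub>R f x"
    and graph: "\<And>s x y. (\<And>n. s n \<in> S) \<Longrightarrow> x \<in> S \<Longrightarrow> s \<longlonglongrightarrow> x \<Longrightarrow> (\<lambda>n. f (s n)) \<longlonglongrightarrow> y \<Longrightarrow> f x = y"
  obtains K where "\<And>x. x \<in> S \<Longrightarrow> norm (f x) \<le> K * norm x"
proof -
  obtain M where M: "M \<ge> 0"
    "\<And>x e. x \<in> S \<Longrightarrow> e > 0 \<Longrightarrow> \<exists>y\<in>S. norm (x - y) < e \<and> norm (f y) \<le> M * norm x"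
    using approx_bound_of_subspace_Baire[OF S add scale] by blast
  have "norm (f x) \<le> 2 * M * norm x" if x: "x \<in> S" for x
  proof (cases "x = 0")
    case True then show ?thesis using scale[OF x, of 0] by simp
  next
    case False
    \<comment> \<open>The tolerance is halved from one index to the next and is positive because
      \<open>x\<close> is nonzero. The membership \<open>z \<in> S\<close> sits inside the
      quantifier so that the choice function is total.\<close>
    have ex: "\<exists>y. z \<in> S \<longrightarrow> y \<in> S \<and> norm (z - y) < norm x / 2 ^ Suc k \<and> norm (f y) \<le> M * norm z" for z k
      using M(2)[of z "norm x / 2 ^ Suc k"] False by auto
    define g where "g k z = (SOME y. z \<in> S \<longrightarrow> y \<in> S \<and> norm (z - y) < norm x / 2 ^ Suc k \<and> norm (f y) \<le> M * norm z)" for k z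
    have g: "g k z \<in> S" "norm (z - g k z) < norm x / 2 ^ Suc k" "norm (f (g k z)) \<le> M * norm z"
      if "z \<in> S" for k z
      using someI_ex[OF ex[of z k]] that unfolding g_def by blast+
    \<comment> \<open>\<open>r k\<close> is the residual after \<open>k\<close> corrections, and the
      partial sum \<open>s k\<close> of the corrections equals \<open>x - r k\<close>.\<close>
    define r where "r = rec_nat x (\<lambda>k z. z - g k z)"
    have r0: "r 0 = x" and rS: "\<And>k. r (Suc k) = r k - g k (r k)" by (simp_all add: r_def)
    have rin: "r k \<in> S" for k
      by (induction k) (auto simp: r0 rS x g(1) subspace_diff[OF S(1)])
    have rn: "norm (r k) \<le> norm x / 2 ^ k" for k
      by (cases k) (use g(2)[OF rin] in \<open>auto simp: r0 rS less_imp_le\<close>)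
    define s where "s k = (\<Sum>i<k. g i (r i))" for k
    have sin: "s k \<in> S" for k unfolding s_def by (intro subspace_sum S g rin)
    have sr: "s k = x - r k" for k by (induction k) (auto simp: s_def r0 rS)
    have fs: "f (s k) = (\<Sum>i<k. f (g i (r i)))" for k
    proof (induction k)
      case 0 then show ?case using scale[OF x, of 0] by (simp add: s_def)
    next
      case (Suc k)
      have "s (Suc k) = s k + g k (r k)" by (simp add: s_def)
      then show ?case using add[OF sin[of k] g(1)[OF rin[of k]]] Suc by simp
    qed
    have half: "(\<lambda>k. norm x / 2 ^ k) = (\<lambda>k. norm x * (1/2) ^ k)" by (auto simp: field_simps)
    have bd: "norm (f (g i (r i))) \<le> M * norm x * (1/2) ^ i" for i
    proof -
      have "norm (f (g i (r i))) \<le> M * norm (r i)" by (rule g(3)[OF rin])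
      also have "\<dots> \<le> M * (norm x / 2 ^ i)" by (intro mult_left_mono rn M)
      finally show ?thesis by (simp add: power_divide)
    qed
    have summ: "summable (\<lambda>i. M * norm x * (1/2) ^ i)" by (intro summable_mult summable_geometric) auto
    have sm: "summable (\<lambda>i. norm (f (g i (r i))))"
      by (rule summable_comparison_test[OF _ summ]) (use bd in auto)
    have "(\<lambda>k. norm x * (1/2) ^ k) \<longlonglongrightarrow> norm x * 0" by (intro tendsto_intros) auto
    then have "r \<longlonglongrightarrow> 0"
      by (intro Lim_null_comparison[of r "\<lambda>k. norm x * (1/2) ^ k"])
         (use rn in \<open>auto simp: power_divide\<close>)
    then have "s \<longlonglongrightarrow> x - 0" unfolding sr[abs_def] by (intro tendsto_intros)
    moreover have "(\<lambda>k. f (s k)) \<longlonglongrightarrow> (\<Sum>i. f (g i (r i)))"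
      unfolding fs by (intro summable_LIMSEQ summable_norm_cancel[OF sm])
    ultimately have "f x = (\<Sum>i. f (g i (r i)))" using sin x by (intro graph) auto
    also have "norm \<dots> \<le> (\<Sum>i. norm (f (g i (r i))))" by (rule summable_norm[OF sm])
    also have "\<dots> \<le> (\<Sum>i. M * norm x * (1/2) ^ i)" by (rule suminf_le[OF bd sm summ])
    also have "\<dots> = 2 * M * norm x"
      by (subst suminf_mult) (auto simp: suminf_geometric)
    finally show ?thesis .
  qed
  then show ?thesis using that by blast
qed

corollary closed_graph_continuous_on:
  fixes f :: "'a::banach \<Rightarrow> 'b::banach"
  assumes S: "subspace S" "closed S"
    and add: "\<And>x y. x \<in> S \<Longrightarrow> y \<in> S \<Longrightarrow> f (x + y) = f x + f y"
    and scale: "\<And>c x. x \<in> S \<Longrightarrow> f (c *\<^sub>R x) = c *\<^sub>R f x"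
    and graph: "\<And>s x y. (\<And>n. s n \<in> S) \<Longrightarrow> x \<in> S \<Longrightarrow> s \<longlonglongrightarrow> x \<Longrightarrow> (\<lambda>n. f (s n)) \<longlonglongrightarrow> y \<Longrightarrow> f x = y"
  shows "continuous_on S f"
proof -
  obtain K where K: "\<And>x. x \<in> S \<Longrightarrow> norm (f x) \<le> K * norm x"
  proof (rule closed_graph[of S f])
    fix s x y
    assume "\<And>n::nat. s n \<in> S" "x \<in> S" "s \<longlonglongrightarrow> x" "(\<lambda>n. f (s n)) \<longlonglongrightarrow> y"
    then show "f x = y" by (rule graph)
  qed (use S add scale in auto)
  have diff: "f x - f y = f (x - y)" if "x \<in> S" "y \<in> S" for x y
    using add[of x "(- 1) *\<^sub>R y"] scale[of y "- 1"] that subspace_scale[OF S(1), of y "-1"] by simp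
  have "(f \<longlongrightarrow> f x) (at x within S)" if x: "x \<in> S" for x
  proof (rule LIM_zero_cancel, rule Lim_null_comparison)
    show "\<forall>\<^sub>F y in at x within S. norm (f y - f x) \<le> K * norm (y - x)"
      using K diff[OF _ x] subspace_diff[OF S(1) _ x] by (auto simp: eventually_at_filter)
    show "((\<lambda>y. K * norm (y - x)) \<longlongrightarrow> 0) (at x within S)"
      by (auto intro!: tendsto_eq_intros)
  qed
  then show ?thesis by (simp add: continuous_on_def)
qed

section \<open>Antiderivatives of vector-valued functions\<close>

lemma antiderivative_on_real_line:
  fixes f :: "real \<Rightarrow> 'a::banach"
  assumes f: "continuous_on UNIV f"
  obtains F where "F 0 = 0" "\<And>t. (F has_vector_derivative f t) (at t)"
proof -
  define F where "F t = (if 0 \<le> t then integral {0..t} f else - integral {t..0} f)" for t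
  have int: "f integrable_on {a..b}" for a b
    by (intro integrable_continuous_real continuous_on_subset[OF f]) auto
  have F: "F s = integral {a..s} f - integral {a..0} f" if "a \<le> s" "a \<le> 0" for a s
  proof (cases "0 \<le> s")
    case True
    then show ?thesis using Henstock_Kurzweil_Integration.integral_combine[OF that(2) True int] by (simp add: F_def algebra_simps)
  next
    case False
    then show ?thesis using Henstock_Kurzweil_Integration.integral_combine[OF that(1) _ int, of 0] by (simp add: F_def algebra_simps)
  qed
  have "(F has_vector_derivative f t) (at t)" for t
  proof -
    \<comment> \<open>With \<open>a\<close> to the left of both \<open>t\<close> and
      \<open>0\<close>, the signed integral \<open>F\<close> differs from the integral starting at
      \<open>a\<close> by a constant on the whole ray beyond \<open>a\<close>; \<open>b\<close> only
      makes \<open>t\<close> an interior point.\<close>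
    define a b where "a = - \<bar>t\<bar> - 1" and "b = \<bar>t\<bar> + 1"
    have ab: "a < t" "t < b" "a \<le> 0" by (auto simp: a_def b_def)
    have "((\<lambda>s. integral {a..s} f) has_vector_derivative f t) (at t within {a..b})"
      using ab by (intro integral_has_vector_derivative continuous_on_subset[OF f]) auto
    then have "((\<lambda>s. integral {a..s} f) has_vector_derivative f t) (at t)"
      using ab by (simp add: at_within_Icc_at)
    then have "((\<lambda>s. integral {a..s} f - integral {a..0} f) has_vector_derivative f t - 0) (at t)"
      by (intro derivative_intros)
    then have "((\<lambda>s. integral {a..s} f - integral {a..0} f) has_vector_derivative f t) (at t)" by simp
    then show ?thesis
      by (rule has_vector_derivative_transform_within_open[of _ _ _ "{a<..}"]) (use ab F[of a] in auto)
  qed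
  moreover have "F 0 = 0" by (simp add: F_def)
  ultimately show ?thesis using that by blast
qed

text \<open>Riemann sums are linear combinations of values of \<open>f\<close>, hence lie in
  \<open>S\<close>, and the integral is a limit of such sums.\<close>

lemma has_integral_in_closed_subspace:
  fixes f :: "real \<Rightarrow> 'a::real_normed_vector"
  assumes S: "subspace S" "closed S" and f: "\<And>t. f t \<in> S" and I: "(f has_integral I) (cbox a b)"
  shows "I \<in> S"
proof -
  have "\<exists>y\<in>S. dist y I < e" if e: "e > 0" for e
  proof -
    obtain \<gamma> where g: "gauge \<gamma>" "\<And>\<D>. \<D> tagged_division_of (cbox a b) \<Longrightarrow> \<gamma> fine \<D> \<Longrightarrow>
        norm ((\<Sum>(x, k)\<in>\<D>. measure lborel k *\<^sub>R f x) - I) < e"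
      using I[unfolded has_integral, rule_format, OF e] by auto
    obtain p where p: "p tagged_division_of (cbox a b)" "\<gamma> fine p"
      by (rule fine_division_exists[OF g(1)])
    have "(\<Sum>(x, k)\<in>p. measure lborel k *\<^sub>R f x) \<in> S"
      using f by (intro subspace_sum[OF S(1)]) (auto intro: subspace_scale[OF S(1)])
    then show ?thesis using g(2)[OF p] by (auto simp: dist_norm)
  qed
  then have "I \<in> closure S" by (auto simp: closure_approachable)
  then show ?thesis using S(2) by simp
qed

text \<open>Taking \<open>S\<close> to be the graph of a closed operator turns this into the
  statement that the operator commutes with integration.\<close>

lemma increment_in_closed_subspace:
  fixes F :: "real \<Rightarrow> 'a::banach"
  assumes S: "subspace S" "closed S" and f: "\<And>t. f t \<in> S"
    and F: "\<And>t. (F has_vector_derivative f t) (at t)"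
  shows "F t - F s \<in> S"
proof -
  have *: "F b - F a \<in> S" if "a \<le> b" for a b
    using fundamental_theorem_of_calculus[OF that has_vector_derivative_at_within[OF F]]
    by (intro has_integral_in_closed_subspace[OF S f, where a = a and b = b]) (simp add: cbox_interval)
  show ?thesis
    using *[of s t] *[of t s] subspace_neg[OF S(1), of "F s - F t"] by (cases "s \<le> t") auto
qed

lemma has_vector_derivative_zero_const:
  fixes F :: "real \<Rightarrow> 'a::real_normed_vector"
  assumes "\<And>t. (F has_vector_derivative 0) (at t)"
  shows "F t = F s"
  using assms by (intro has_derivative_zero_unique[of UNIV]) (auto simp: has_vector_derivative_def)

section \<open>Strongly continuous groups\<close>

text \<open>Puts derivatives in the form of the difference quotients by which the generator is
  defined.\<close>

lemma has_vector_derivative_at_iff_quotient: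
  fixes f :: "real \<Rightarrow> 'a::real_normed_vector"
  shows "(f has_vector_derivative D) (at x) \<longleftrightarrow> ((\<lambda>h. (f (x + h) - f x) /\<^sub>R h) \<longlongrightarrow> D) (at 0)"
proof -
  have "norm (f (x + h) - f x - h *\<^sub>R D) / norm h = norm ((f (x + h) - f x) /\<^sub>R h - D)" if "h \<noteq> 0" for h
  proof -
    have "f (x + h) - f x - h *\<^sub>R D = h *\<^sub>R ((f (x + h) - f x) /\<^sub>R h - D)"
      using that by (simp add: scaleR_diff_right)
    then show ?thesis using that by simp
  qed
  then have "((\<lambda>h. norm (f (x + h) - f x - h *\<^sub>R D) / norm h) \<longlongrightarrow> 0) (at 0) \<longleftrightarrow>
      ((\<lambda>h. norm ((f (x + h) - f x) /\<^sub>R h - D)) \<longlongrightarrow> 0) (at 0)"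
    by (intro Lim_cong_within) auto
  also have "\<dots> \<longleftrightarrow> ((\<lambda>h. (f (x + h) - f x) /\<^sub>R h) \<longlongrightarrow> D) (at 0)"
    by (simp only: tendsto_norm_zero_iff LIM_zero_iff)
  finally show ?thesis
    by (simp add: has_vector_derivative_def has_derivative_at bounded_linear_scaleR_left)
qed

lemma C0_groupD:
  assumes "C0_group T"
  shows "bounded_linear (T t)" and "T 0 x = x" and "T (s + t) x = T s (T t x)"
    and "continuous_on UNIV (\<lambda>t. T t x)"
  using assms by (auto simp: C0_group_def bounded_clinear_def)

instance bcontfun :: (metric_space, banach) banach ..

text \<open>The uniform boundedness principle on a compact time interval, obtained from the closed graph
  theorem for the map sending \<open>x\<close> to its orbit, an element of a space of bounded continuous functions.\<close>

lemma C0_group_bounded: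
  fixes T :: "real \<Rightarrow> 'a::complex_banach \<Rightarrow> 'a"
  assumes T: "C0_group T"
  obtains M where "\<And>t x. \<bar>t\<bar> \<le> 1 \<Longrightarrow> norm (T t x) \<le> M * norm x"
proof -
  \<comment> \<open>Clamping the time to \<open>[-1, 1]\<close> makes each orbit a bounded
    continuous function on the line without changing it on that interval.\<close>
  have "\<exists>g :: real \<Rightarrow>\<^sub>C 'a. \<forall>t. g t = T (clamp (- 1) 1 t) x" for x
    using continuous_on_cbox_bcontfunE[OF continuous_on_subset[OF C0_groupD(4)[OF T]], of "- 1" 1 x]
    by auto
  then obtain g :: "'a \<Rightarrow> real \<Rightarrow>\<^sub>C 'a" where g: "\<And>x t. g x t = T (clamp (- 1) 1 t) x"
    by metis
  obtain K where K: "\<And>x. x \<in> UNIV \<Longrightarrow> norm (g x) \<le> K * norm x"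
  proof (rule closed_graph[of UNIV g])
    show "g (x + y) = g x + g y" for x y
      by (rule bcontfun_eqI) (simp add: g linear_add bounded_linear.linear[OF C0_groupD(1)[OF T]])
    show "g (c *\<^sub>R x) = c *\<^sub>R g x" for c x
      by (rule bcontfun_eqI) (simp add: g linear_scale bounded_linear.linear[OF C0_groupD(1)[OF T]])
    fix s :: "nat \<Rightarrow> 'a" and x y
    assume s: "s \<longlonglongrightarrow> x" and gs: "(\<lambda>n. g (s n)) \<longlonglongrightarrow> y"
    show "g x = y"
    proof (rule bcontfun_eqI)
      fix t
      have "(\<lambda>n. g (s n) t) \<longlonglongrightarrow> g x t"
        unfolding g by (rule bounded_linear.tendsto[OF C0_groupD(1)[OF T] s])
      moreover have "(\<lambda>n. g (s n) t) \<longlonglongrightarrow> y t"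
        by (rule metric_tendsto_imp_tendsto[OF gs]) (simp add: dist_bounded)
      ultimately show "g x t = y t" by (rule LIMSEQ_unique)
    qed
  qed auto
  have "norm (T t x) \<le> K * norm x" if "\<bar>t\<bar> \<le> 1" for t x
  proof -
    have "clamp (- 1) 1 t = t" using that by (intro clamp_cancel_cbox) (auto simp: cbox_interval)
    then have "norm (T t x) = norm (g x t)" by (simp add: g)
    also have "\<dots> \<le> norm (g x)" by (rule norm_bounded)
    finally show ?thesis using K[of x] by simp
  qed
  then show ?thesis using that by blast
qed

text \<open>\<open>T t\<close> commutes with every \<open>T h\<close>, so applying the bounded
  operator \<open>T t\<close> to the difference quotient of \<open>z\<close> yields that of
  \<open>T t z\<close>. This one limit gives all three claims.\<close>

lemma C0_group_orbit:
  fixes T :: "real \<Rightarrow> 'a::complex_banach \<Rightarrow> 'a"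
  assumes gen: "generates_C0_group D G T" and z: "z \<in> D"
  shows "T t z \<in> D" and "G (T t z) = T t (G z)"
    and "((\<lambda>t. T t z) has_vector_derivative T t (G z)) (at t)"
proof -
  have T: "C0_group T" and D: "D = {x. \<exists>z. ((\<lambda>t. (T t x - x) /\<^sub>R t) \<longlongrightarrow> z) (at 0)}"
    and G: "\<And>x. x \<in> D \<Longrightarrow> ((\<lambda>t. (T t x - x) /\<^sub>R t) \<longlongrightarrow> G x) (at 0)"
    using gen by (auto simp: generates_C0_group_def)
  interpret bounded_linear "T t" by (rule C0_groupD(1)[OF T])
  have lim: "((\<lambda>h. T t ((T h z - z) /\<^sub>R h)) \<longlongrightarrow> T t (G z)) (at 0)"
    by (rule tendsto[OF G[OF z]])
  have "T t (T h z) = T h (T t z)" for h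
    using C0_groupD(3)[OF T, of t h z] C0_groupD(3)[OF T, of h t z] by (simp add: add.commute)
  then have "((\<lambda>h. (T h (T t z) - T t z) /\<^sub>R h) \<longlongrightarrow> T t (G z)) (at 0)"
    using lim by (simp add: diff scaleR)
  then show "T t z \<in> D" "G (T t z) = T t (G z)"
    using D G[of "T t z"] tendsto_unique[OF at_neq_bot] by blast+
  show "((\<lambda>t. T t z) has_vector_derivative T t (G z)) (at t)"
    using lim by (simp add: has_vector_derivative_at_iff_quotient C0_groupD(3)[OF T] diff scaleR)
qed

text \<open>A product rule for \<open>T (t - s) (Z s)\<close> shows that its derivative in
  \<open>s\<close> vanishes. The group is only strongly continuous, so the remainder term needs the
  uniform bound on \<open>T\<close> near time \<open>0\<close>.\<close>

lemma C0_group_Cauchy_unique: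
  fixes T :: "real \<Rightarrow> 'a::complex_banach \<Rightarrow> 'a"
  assumes gen: "generates_C0_group D G T" and Z: "\<And>t. Z t \<in> D"
    and Z': "\<And>t. (Z has_vector_derivative G (Z t)) (at t)"
  shows "Z t = T t (Z 0)"
proof -
  have T: "C0_group T" and G: "\<And>x. x \<in> D \<Longrightarrow> ((\<lambda>t. (T t x - x) /\<^sub>R t) \<longlongrightarrow> G x) (at 0)"
    using gen by (auto simp: generates_C0_group_def)
  note lin = bounded_linear.linear[OF C0_groupD(1)[OF T]]
  obtain M where M: "\<And>t x. \<bar>t\<bar> \<le> 1 \<Longrightarrow> norm (T t x) \<le> M * norm x"
    using C0_group_bounded[OF T] by blast
  have "((\<lambda>s. T (t - s) (Z s)) has_vector_derivative 0) (at s)" for s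
  proof -
    \<comment> \<open>The remainder in the difference quotient of \<open>Z\<close>. It tends to
      \<open>0\<close>, and by the bound \<open>M\<close> so does \<open>T (- h) (e h)\<close>,
      although the operator varies with \<open>h\<close>.\<close>
    define e where "e h = (Z (s + h) - Z s) /\<^sub>R h - G (Z s)" for h
    have e: "(e \<longlongrightarrow> 0) (at 0)"
      using Z'[of s] unfolding has_vector_derivative_at_iff_quotient e_def by (simp add: LIM_zero)
    have "\<forall>\<^sub>F h in at 0. \<bar>h\<bar> < (1::real)"
      using tendsto_rabs[OF tendsto_ident_at[of "0::real" UNIV]] by (rule order_tendstoD) simp
    then have "((\<lambda>h. T (- h) (e h)) \<longlongrightarrow> 0) (at 0)"
      by (intro Lim_null_comparison[OF _ tendsto_mult_right_zero[OF tendsto_norm_zero[OF e], of M]])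
         (auto elim!: eventually_mono intro!: M)
    moreover have "((\<lambda>h. T (- h) (G (Z s))) \<longlongrightarrow> T (- 0) (G (Z s))) (at 0)"
      using C0_groupD(4)[OF T, of "G (Z s)"]
      by (intro isCont_tendsto_compose[of _ "\<lambda>t. T t (G (Z s))"] tendsto_intros)
         (simp add: continuous_on_eq_continuous_at)
    moreover have "((\<lambda>h. - ((T (- h) (Z s) - Z s) /\<^sub>R (- h))) \<longlongrightarrow> - G (Z s)) (at 0)"
    proof (intro tendsto_minus filterlim_compose[OF G[OF Z]])
      show "filterlim uminus (at 0) (at (0::real))"
        using filterlim_at[of "\<lambda>h::real. - h" 0 UNIV "at 0"] tendsto_minus[OF tendsto_ident_at[of "0::real" UNIV]]
        by (auto simp: eventually_at_filter)
    qed
    ultimately have "((\<lambda>h. T (- h) (e h) + T (- h) (G (Z s)) - (T (- h) (Z s) - Z s) /\<^sub>R (- h))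
        \<longlongrightarrow> 0 + T (- 0) (G (Z s)) + - G (Z s)) (at 0)"
      unfolding diff_conv_add_uminus[of "_ + _" "_ /\<^sub>R _"] by (intro tendsto_add)
    then have "((\<lambda>h. T (t - s) (T (- h) (e h) + T (- h) (G (Z s)) - (T (- h) (Z s) - Z s) /\<^sub>R (- h)))
        \<longlongrightarrow> T (t - s) 0) (at 0)"
      by (intro bounded_linear.tendsto[OF C0_groupD(1)[OF T]]) (simp add: C0_groupD(2)[OF T])
    also have "T (t - s) 0 = 0" by (rule linear_0[OF lin])
    \<comment> \<open>The identity holds for every \<open>h\<close>: at \<open>h = 0\<close> both
      sides vanish because division by zero yields zero.\<close>
    also have "(\<lambda>h. T (t - s) (T (- h) (e h) + T (- h) (G (Z s)) - (T (- h) (Z s) - Z s) /\<^sub>R (- h))) =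
        (\<lambda>h. (T (t - (s + h)) (Z (s + h)) - T (t - s) (Z s)) /\<^sub>R h)"
    proof
      fix h
      have "T (t - (s + h)) (Z (s + h)) = T (t - s) (T (- h) (Z (s + h)))"
        using C0_groupD(3)[OF T, of "t - s" "- h"] by (simp add: algebra_simps)
      then show "T (t - s) (T (- h) (e h) + T (- h) (G (Z s)) - (T (- h) (Z s) - Z s) /\<^sub>R (- h)) =
        (T (t - (s + h)) (Z (s + h)) - T (t - s) (Z s)) /\<^sub>R h"
        by (simp add: e_def linear_add[OF lin] linear_diff[OF lin] linear_scale[OF lin] linear_neg[OF lin] scaleR_diff_right)
    qed
    finally show ?thesis unfolding has_vector_derivative_at_iff_quotient .
  qed
  \<comment> \<open>Compare the values at \<open>s = t\<close>, namely \<open>T 0 (Z t)\<close>, and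
    at \<open>s = 0\<close>.\<close>
  from has_vector_derivative_zero_const[OF this, of t 0] show ?thesis
    by (simp add: C0_groupD(2)[OF T])
qed

section \<open>Closed operators\<close>

lemma linear_operatorD:
  assumes "linear_operator D A"
  shows "subspace D" and "\<And>x y. x \<in> D \<Longrightarrow> y \<in> D \<Longrightarrow> A (x + y) = A x + A y"
    and "\<And>c x. x \<in> D \<Longrightarrow> A (c *\<^sub>R x) = c *\<^sub>R A x"
    and "\<And>x y. x \<in> D \<Longrightarrow> y \<in> D \<Longrightarrow> A (x - y) = A x - A y"
    and "A 0 = 0"
proof -
  show S: "subspace D" and add: "\<And>x y. x \<in> D \<Longrightarrow> y \<in> D \<Longrightarrow> A (x + y) = A x + A y"
    and scale: "\<And>c x. x \<in> D \<Longrightarrow> A (c *\<^sub>R x) = c *\<^sub>R A x"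
    using assms by (auto simp: linear_operator_def subspace_def scaleR_scaleC)
  show "A (x - y) = A x - A y" if "x \<in> D" "y \<in> D" for x y
    using add[of x "(- 1) *\<^sub>R y"] scale[of y "- 1"] that subspace_scale[OF S, of y "-1"] by simp
  show "A 0 = 0" using scale[OF subspace_0[OF S], of 0] by simp
qed

lemma closed_linear_operatorD:
  assumes "closed_linear_operator D A"
  shows "linear_operator D A" and "closed ((\<lambda>x. (x, A x)) ` D)" and "subspace ((\<lambda>x. (x, A x)) ` D)"
proof -
  show A: "linear_operator D A" and "closed ((\<lambda>x. (x, A x)) ` D)"
    using assms by (auto simp: closed_linear_operator_def)
  show "subspace ((\<lambda>x. (x, A x)) ` D)"
    using linear_operatorD[OF A] unfolding subspace_def
    by (auto simp: image_iff zero_prod_def)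
qed

lemma closed_operator_limit:
  assumes A: "closed_linear_operator D A" and s: "\<And>n. s n \<in> D" "s \<longlonglongrightarrow> x" "(\<lambda>n. A (s n)) \<longlonglongrightarrow> y"
  shows "x \<in> D" and "A x = y"
proof -
  have "(x, y) \<in> (\<lambda>x. (x, A x)) ` D"
    by (rule closed_sequentially[OF closed_linear_operatorD(2)[OF A] _ tendsto_Pair[OF s(2,3)]]) (use s(1) in auto)
  then show "x \<in> D" "A x = y" by auto
qed

text \<open>The pair \<open>(F, H)\<close> starts in the graph of \<open>A\<close>, a closed
  subspace, and its derivative stays there; hence so does the pair itself.\<close>

lemma closed_operator_antiderivative:
  fixes A :: "'x::complex_banach \<Rightarrow> 'y::complex_banach"
  assumes A: "closed_linear_operator D A" and f: "\<And>t. f t \<in> D"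
    and F: "\<And>t. (F has_vector_derivative f t) (at t)" and H: "\<And>t. (H has_vector_derivative A (f t)) (at t)"
    and 0: "F 0 \<in> D" "H 0 = A (F 0)"
  shows "F t \<in> D" and "A (F t) = H t"
proof -
  let ?S = "(\<lambda>x. (x, A x)) ` D"
  have "(F t, H t) - (F 0, H 0) \<in> ?S"
    using f by (intro increment_in_closed_subspace[OF closed_linear_operatorD(3,2)[OF A],
          where f = "\<lambda>t. (f t, A (f t))"] has_vector_derivative_Pair F H) auto
  moreover have "(F 0, H 0) \<in> ?S" using 0 by simp
  ultimately have "(F t, H t) - (F 0, H 0) + (F 0, H 0) \<in> ?S"
    by (rule subspace_add[OF closed_linear_operatorD(3)[OF A]])
  then show "F t \<in> D" "A (F t) = H t" by auto
qed

text \<open>The graph of \<open>A\<close> is a closed subspace of a product of Banach spaces, and by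
  the closed graph theorem \<open>f\<close> is continuous for the graph norm. The curve
  \<open>(u t, A (u t))\<close> is continuous into that graph.\<close>

lemma closed_operator_dominates:
  fixes A :: "'x::complex_banach \<Rightarrow> 'z::complex_banach" and f :: "'x \<Rightarrow> 'y::banach"
    and u :: "real \<Rightarrow> 'x"
  assumes A: "closed_linear_operator D A"
    and add: "\<And>x y. x \<in> D \<Longrightarrow> y \<in> D \<Longrightarrow> f (x + y) = f x + f y"
    and scale: "\<And>c x. x \<in> D \<Longrightarrow> f (c *\<^sub>R x) = c *\<^sub>R f x"
    and closable: "\<And>s x y. (\<And>n. s n \<in> D) \<Longrightarrow> x \<in> D \<Longrightarrow> s \<longlonglongrightarrow> x \<Longrightarrow> (\<lambda>n. f (s n)) \<longlonglongrightarrow> y \<Longrightarrow> f x = y"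
    and u: "\<And>t. u t \<in> D" "continuous_on UNIV u" "continuous_on UNIV (\<lambda>t. A (u t))"
  shows "continuous_on UNIV (\<lambda>t. f (u t))"
proof -
  let ?S = "(\<lambda>x. (x, A x)) ` D"
  have "continuous_on ?S (\<lambda>p. f (fst p))"
  proof (rule closed_graph_continuous_on[OF closed_linear_operatorD(3,2)[OF A]])
    fix s :: "nat \<Rightarrow> 'x \<times> 'z" and p y
    assume s: "\<And>n. s n \<in> ?S" "p \<in> ?S" "s \<longlonglongrightarrow> p" "(\<lambda>n. f (fst (s n))) \<longlonglongrightarrow> y"
    have "fst (s n) \<in> D" for n using s(1)[of n] by auto
    then show "f (fst p) = y"
      using s(2) by (intro closable[OF _ _ tendsto_fst[OF s(3)] s(4)]) auto
  qed (use add scale in auto)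
  then have "continuous_on UNIV (\<lambda>t. f (fst (u t, A (u t))))"
    by (rule continuous_on_compose2[where f = "\<lambda>t. (u t, A (u t))"]) (use u in \<open>auto intro!: continuous_intros\<close>)
  then show ?thesis by simp
qed

section \<open>Classical solutions\<close>

text \<open>Replaces the derivatives chosen by \<open>vderiv\<close> by explicit witnesses, which
  can be supplied and manipulated directly.\<close>

lemma classical_solution_iff:
  "classical_solution domA A domB B x y u \<longleftrightarrow>
    (\<exists>u' u''. (\<forall>t. (u has_vector_derivative u' t) (at t)) \<and> (\<forall>t. (u' has_vector_derivative u'' t) (at t)) \<and>
      continuous_on UNIV u'' \<and> (\<forall>t. u t \<in> domA \<and> u' t \<in> domB) \<and> continuous_on UNIV (\<lambda>t. A (u t)) \<and>
      (\<forall>t. u'' t + 2 *\<^sub>R B (u' t) = A (u t)) \<and> u 0 = x \<and> u' 0 = y)" (is "?L \<longleftrightarrow> ?R")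
proof
  assume ?L
  then show ?R
    unfolding classical_solution_def C1_differentiable_on_eq vector_derivative_works
    by (intro exI[of _ "vderiv u"] exI[of _ "vderiv (vderiv u)"]) auto
next
  assume ?R
  then obtain u' u'' where u: "\<forall>t. (u has_vector_derivative u' t) (at t)"
    "\<forall>t. (u' has_vector_derivative u'' t) (at t)" and
    rest: "continuous_on UNIV u''" "\<forall>t. u t \<in> domA \<and> u' t \<in> domB" "continuous_on UNIV (\<lambda>t. A (u t))"
      "\<forall>t. u'' t + 2 *\<^sub>R B (u' t) = A (u t)" "u 0 = x" "u' 0 = y" by blast
  have "vderiv u = u'" "vderiv u' = u''" using u by (auto intro!: ext vector_derivative_at)
  then show ?L unfolding classical_solution_def C1_differentiable_on_eq
    using u rest by (auto intro: differentiableI_vector)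
qed

section \<open>The second order problem: setting, existence and uniqueness\<close>

locale second_order_problem =
  fixes A B :: "'x::complex_banach \<Rightarrow> 'x" and domA domB :: "'x set"
    and j :: "'y::complex_banach \<Rightarrow> 'x"
    and T :: "real \<Rightarrow> 'y \<times> 'x \<Rightarrow> 'y \<times> 'x"
  assumes A: "closed_linear_operator domA A"
    and B: "closed_linear_operator domB B"
    and emb: "continuous_embedding j"
    and domA: "domA \<subseteq> dom_square domB B \<inter> range j"
    and B_domA: "B ` domA \<subseteq> range j" and range_j: "range j \<subseteq> domB"
    and gen: "generates_C0_group (dom_G j domA) (op_G j A B) T"
begin

lemma domA_D:
  assumes "v \<in> domA" shows "v \<in> domB" "B v \<in> domB" "v \<in> range j" "B v \<in> range j"
  using assms domA B_domA by (auto simp: dom_square_def)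

lemma j_domB [simp]: "j v \<in> domB" using range_j by auto

lemma bounded_linear_j: "bounded_linear j" and inv_j_j [simp]: "inv j (j v) = v"
  using emb by (auto simp: continuous_embedding_def bounded_clinear_def)

lemma j_inv_j: "x \<in> range j \<Longrightarrow> j (inv j x) = x" by (rule f_inv_into_f)

sublocale j: bounded_linear j by (rule bounded_linear_j)

lemma inv_j_eqI: "j v = x \<Longrightarrow> inv j x = v" by auto

lemmas A_lin = linear_operatorD[OF closed_linear_operatorD(1)[OF A]]
lemmas B_lin = linear_operatorD[OF closed_linear_operatorD(1)[OF B]]

text \<open>\<open>j\<close> is continuous and \<open>B\<close> is closed, so the everywhere defined
  composition has a closed graph.\<close>

lemma bounded_linear_B_j: "bounded_linear (\<lambda>v. B (j v))"
proof -
  obtain K where K: "\<And>v. v \<in> UNIV \<Longrightarrow> norm (B (j v)) \<le> K * norm v"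
  proof (rule closed_graph[of UNIV "\<lambda>v. B (j v)"])
    fix s :: "nat \<Rightarrow> 'y" and v w
    assume "s \<longlonglongrightarrow> v" "(\<lambda>n. B (j (s n))) \<longlonglongrightarrow> w"
    then show "B (j v) = w"
      by (intro closed_operator_limit(2)[OF B, of "\<lambda>n. j (s n)"] j.tendsto) auto
  qed (auto simp: j.add j.scaleR B_lin)
  then show ?thesis
    by (intro bounded_linear_intro[of _ K]) (auto simp: j.add j.scaleR B_lin mult.commute)
qed

text \<open>The first row of \<open>G\<close> reads \<open>j v' = w - B (j v)\<close>. Its right
  side is differentiable in \<open>X\<close> because \<open>B\<close> after \<open>j\<close> is
  bounded, which gives the second derivative of \<open>u\<close>. The second row then turns into the
  equation.\<close>

lemma classical_solution_orbit:
  assumes x: "x \<in> domA" and y: "y \<in> range j"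
  shows "classical_solution domA A domB B x y (\<lambda>t. j (fst (T t (inv j x, y + B x))))"
proof -
  let ?G = "op_G j A B"
  define z where "z = (inv j x, y + B x)"
  have jx: "j (inv j x) = x" by (intro j_inv_j domA_D x)
  have yB: "y + B x \<in> range j"
    using y domA_D(4)[OF x] by (auto simp flip: j.add)
  have z: "z \<in> dom_G j domA" by (simp add: z_def dom_G_def jx x yB)
  have T: "C0_group T" using gen by (simp add: generates_C0_group_def)
  define v w v' w' where vw: "v t = fst (T t z)" "w t = snd (T t z)"
    "v' t = fst (T t (?G z))" "w' t = snd (T t (?G z))" for t
  have Tz: "T t z = (v t, w t)" and TGz: "T t (?G z) = (v' t, w' t)" for t by (simp_all add: vw)
  have dom: "j (v t) \<in> domA" "w t \<in> range j" for t
    using C0_group_orbit(1)[OF gen z, of t] by (auto simp: Tz dom_G_def)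
  have der: "(v has_vector_derivative v' t) (at t)" "(w has_vector_derivative w' t) (at t)" for t
    using bounded_linear.has_vector_derivative[OF bounded_linear_fst C0_group_orbit(3)[OF gen z, of t]]
      bounded_linear.has_vector_derivative[OF bounded_linear_snd C0_group_orbit(3)[OF gen z, of t]]
    by (simp_all add: Tz TGz)
  have cont: "continuous_on UNIV v'" "continuous_on UNIV w'"
    using C0_groupD(4)[OF T, of "?G z"] unfolding vw by (intro continuous_intros; assumption)+
  have eq: "v' t = inv j (- B (j (v t)) + w t)" "w' t = A (j (v t)) + B (B (j (v t))) - B (w t)" for t
    using C0_group_orbit(2)[OF gen z, of t, unfolded Tz TGz] by (simp_all add: op_G_def)
  \<comment> \<open>Both \<open>w t\<close> and \<open>B (j (v t))\<close> lie in
    \<open>range j\<close>, so \<open>inv j\<close> in the first row can be undone.\<close>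
  have jv': "j (v' t) = w t - B (j (v t))" for t
  proof -
    obtain p q where "w t = j p" "B (j (v t)) = j q" using dom(2)[of t] domA_D(4)[OF dom(1)[of t]] by auto
    then have "w t - B (j (v t)) = j (p - q)" by (simp add: j.diff)
    then show ?thesis by (simp add: eq)
  qed
  define u u' u'' where u: "u t = j (v t)" "u' t = j (v' t)" "u'' t = w' t - B (j (v' t))" for t
  have "(u has_vector_derivative u' t) (at t)" for t
    unfolding u by (rule j.has_vector_derivative[OF der(1)])
  moreover have "(u' has_vector_derivative u'' t) (at t)" for t
  proof -
    have "((\<lambda>t. w t - B (j (v t))) has_vector_derivative u'' t) (at t)"
      unfolding u(3)
      by (intro has_vector_derivative_diff der bounded_linear.has_vector_derivative[OF bounded_linear_B_j])
    moreover have "u' = (\<lambda>t. w t - B (j (v t)))" by (simp add: u jv' fun_eq_iff)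
    ultimately show ?thesis by simp
  qed
  moreover have cu'': "continuous_on UNIV u''"
    unfolding u by (intro continuous_intros cont bounded_linear.continuous_on[OF bounded_linear_B_j])
  moreover have eq2: "u'' t + 2 *\<^sub>R B (u' t) = A (u t)" for t
  proof -
    have "B (j (v' t)) = B (w t) - B (B (j (v t)))"
      unfolding jv' using dom range_j domA_D by (intro B_lin) auto
    then show ?thesis by (simp add: u eq scaleR_2)
  qed
  \<comment> \<open>Continuity of \<open>A u\<close> is read off the equation, whose other terms are
    already continuous.\<close>
  moreover have "continuous_on UNIV (\<lambda>t. A (u t))"
    unfolding eq2[symmetric] u(2)
    by (intro continuous_intros cont cu'' bounded_linear.continuous_on[OF bounded_linear_B_j])
  moreover have "u t \<in> domA \<and> u' t \<in> domB" for t using dom by (simp add: u)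
  moreover have "T 0 z = z" by (rule C0_groupD(2)[OF T])
  then have "v 0 = inv j x" "w 0 = y + B x" by (simp_all add: vw z_def)
  then have "u 0 = x" "u' 0 = y" using jx by (simp_all add: u jv')
  ultimately have "classical_solution domA A domB B x y u"
    unfolding classical_solution_iff by blast
  moreover have "u = (\<lambda>t. j (fst (T t (inv j x, y + B x))))" by (simp add: fun_eq_iff u vw z_def)
  ultimately show ?thesis by simp
qed

text \<open>A classical solution \<open>u\<close> has \<open>u'\<close> in \<open>domB\<close> only, so \<open>(u, u' + B u)\<close> need not be an
  orbit in \<open>dom_G\<close>. Its antiderivative \<open>Z\<close> however is, by closedness of the operators.\<close>

lemma classical_solution_zero:
  assumes "classical_solution domA A domB B 0 0 u"
  shows "u t = 0"
proof -
  obtain u' u'' where u: "\<And>t. (u has_vector_derivative u' t) (at t)"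
    and u': "\<And>t. (u' has_vector_derivative u'' t) (at t)"
    and cu'': "continuous_on UNIV u''" and dom: "\<And>t. u t \<in> domA" "\<And>t. u' t \<in> domB"
    and cA: "continuous_on UNIV (\<lambda>t. A (u t))"
    and eq: "\<And>t. u'' t + 2 *\<^sub>R B (u' t) = A (u t)" and 0: "u 0 = 0" "u' 0 = 0"
    using assms unfolding classical_solution_iff by blast
  have cu: "continuous_on UNIV u"
    using has_vector_derivative_continuous[OF u] by (simp add: continuous_on_eq_continuous_at)
  \<comment> \<open>Solving the equation for \<open>B u'\<close> shows that it is continuous and
    hence has an antiderivative.\<close>
  have Bu': "B (u' t) = (1/2) *\<^sub>R (A (u t) - u'' t)" for t
    by (simp flip: eq)
  have cBu': "continuous_on UNIV (\<lambda>t. B (u' t))"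
    unfolding Bu' by (intro continuous_intros cA cu'')
  \<comment> \<open>Used below with \<open>f\<close> the identity, for \<open>v\<close>, and with
    \<open>f = B\<close>, for \<open>q\<close>.\<close>
  have add: "inv j (f (x + y)) = inv j (f x) + inv j (f y)"
    if "f (x + y) = f x + f y" "f x \<in> range j" "f y \<in> range j" for f :: "'x \<Rightarrow> 'x" and x y
    using that by (intro inv_j_eqI) (simp add: j.add j_inv_j)
  have scale: "inv j (f (c *\<^sub>R x)) = c *\<^sub>R inv j (f x)"
    if "f (c *\<^sub>R x) = c *\<^sub>R f x" "f x \<in> range j" for f :: "'x \<Rightarrow> 'x" and c x
    using that by (intro inv_j_eqI) (simp add: j.scaleR j_inv_j)
  define v q where "v t = inv j (u t)" and "q t = inv j (B (u t))" for t
  have jv: "j (v t) = u t" and jq: "j (q t) = B (u t)" for t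
    unfolding v_def q_def by (intro j_inv_j domA_D dom)+
  \<comment> \<open>On \<open>domA\<close> the norm of \<open>Y\<close> is dominated by the graph
    norm of \<open>A\<close>: a limit in \<open>Y\<close> is also a limit in \<open>X\<close>, so
    \<open>inv j\<close> satisfies the closability condition. For \<open>q\<close> the closedness of
    \<open>B\<close> enters as well.\<close>
  have cv: "continuous_on UNIV v"
    unfolding v_def
  proof (rule closed_operator_dominates[OF A _ _ _ dom(1) cu cA])
    show "inv j (a + b) = inv j a + inv j b" if "a \<in> domA" "b \<in> domA" for a b
      using add[of "\<lambda>x. x" a b] domA_D that by auto
    show "inv j (c *\<^sub>R a) = c *\<^sub>R inv j a" if "a \<in> domA" for c a
      using scale[of "\<lambda>x. x" c a] domA_D that by auto
    fix s :: "nat \<Rightarrow> 'x" and a b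
    assume s: "\<And>n. s n \<in> domA" "a \<in> domA" "s \<longlonglongrightarrow> a" "(\<lambda>n. inv j (s n)) \<longlonglongrightarrow> b"
    have "(\<lambda>n. j (inv j (s n))) \<longlonglongrightarrow> j b" by (rule j.tendsto[OF s(4)])
    then have "s \<longlonglongrightarrow> j b" using s(1) by (simp add: j_inv_j domA_D)
    then show "inv j a = b" using s(3) by (intro inv_j_eqI) (rule LIMSEQ_unique)
  qed
  have cq: "continuous_on UNIV q"
    unfolding q_def
  proof (rule closed_operator_dominates[OF A _ _ _ dom(1) cu cA])
    show "inv j (B (a + b)) = inv j (B a) + inv j (B b)" if "a \<in> domA" "b \<in> domA" for a b
      using add[of B a b] domA_D that by (auto simp: B_lin)
    show "inv j (B (c *\<^sub>R a)) = c *\<^sub>R inv j (B a)" if "a \<in> domA" for c a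
      using scale[of B c a] domA_D that by (auto simp: B_lin)
    fix s :: "nat \<Rightarrow> 'x" and a b
    assume s: "\<And>n. s n \<in> domA" "a \<in> domA" "s \<longlonglongrightarrow> a" "(\<lambda>n. inv j (B (s n))) \<longlonglongrightarrow> b"
    have "(\<lambda>n. j (inv j (B (s n)))) \<longlonglongrightarrow> j b" by (rule j.tendsto[OF s(4)])
    then have "(\<lambda>n. B (s n)) \<longlonglongrightarrow> j b" using s(1) by (simp add: j_inv_j domA_D)
    then show "inv j (B a) = b"
      using s by (intro inv_j_eqI closed_operator_limit(2)[OF B _ s(3), symmetric]) (auto simp: domA_D)
  qed
  obtain V where V: "V 0 = 0" "\<And>t. (V has_vector_derivative v t) (at t)"
    using antiderivative_on_real_line[OF cv] by blast
  obtain Q where Q: "Q 0 = 0" "\<And>t. (Q has_vector_derivative q t) (at t)"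
    using antiderivative_on_real_line[OF cq] by blast
  obtain AA where AA: "AA 0 = 0" "\<And>t. (AA has_vector_derivative A (u t)) (at t)"
    using antiderivative_on_real_line[OF cA] by blast
  obtain BB where BB: "BB 0 = 0" "\<And>t. (BB has_vector_derivative B (u' t)) (at t)"
    using antiderivative_on_real_line[OF cBu'] by blast
  have jV: "((\<lambda>t. j (V t)) has_vector_derivative u t) (at t)"
    and jQ: "((\<lambda>t. j (Q t)) has_vector_derivative B (u t)) (at t)" for t
    using j.has_vector_derivative[OF V(2)] j.has_vector_derivative[OF Q(2)] by (simp_all add: jv jq)
  have AV: "j (V t) \<in> domA" "A (j (V t)) = AA t" for t
    by (rule closed_operator_antiderivative[OF A dom(1) jV AA(2)];
        simp add: V AA j.zero A_lin subspace_0)+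
  have BV: "B (j (V t)) = j (Q t)" for t
    by (rule closed_operator_antiderivative(2)[OF B _ jV jQ])
       (simp_all add: V Q j.zero B_lin subspace_0 domA_D dom)
  \<comment> \<open>Here \<open>B\<close> is moved under the integral of \<open>u'\<close>, using
    \<open>u 0 = 0\<close>.\<close>
  have Bu: "B (u t) = BB t" for t
    by (rule closed_operator_antiderivative(2)[OF B dom(2) u BB(2)])
       (simp_all add: 0 BB B_lin subspace_0)
  \<comment> \<open>The equation is integrated once; the constant vanishes by the zero initial
    data.\<close>
  have "((\<lambda>t. u' t - AA t + 2 *\<^sub>R BB t) has_vector_derivative 0) (at t)" for t
  proof -
    have "((\<lambda>t. u' t - AA t + 2 *\<^sub>R BB t) has_vector_derivative u'' t - A (u t) + 2 *\<^sub>R B (u' t)) (at t)"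
      by (intro has_vector_derivative_add has_vector_derivative_diff u' AA
          bounded_linear.has_vector_derivative[OF bounded_linear_scaleR_right] BB)
    then show ?thesis by (simp flip: eq)
  qed
  from has_vector_derivative_zero_const[OF this, of _ 0]
  have u'_eq: "u' t = AA t - 2 *\<^sub>R BB t" for t
    by (simp add: 0 AA BB add_eq_0_iff algebra_simps)
  define Z where "Z t = (V t, u t + j (Q t))" for t
  have Zdom: "Z t \<in> dom_G j domA" for t
    using AV by (simp add: Z_def dom_G_def flip: jv j.add)
  \<comment> \<open>In the first row \<open>B (j (V t))\<close> cancels \<open>j (Q t)\<close>. In
    the second the terms \<open>B (j (Q t))\<close> cancel, leaving \<open>AA t - B (u t)\<close>,
    which is \<open>u' t + B (u t)\<close> because \<open>BB t = B (u t)\<close>.\<close>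
  have "op_G j A B (Z t) = (v t, u' t + B (u t))" for t
  proof -
    have "B (u t + j (Q t)) = B (u t) + B (j (Q t))"
      by (intro B_lin) (simp_all add: domA_D dom)
    then show ?thesis
      by (simp add: Z_def op_G_def BV AV u'_eq Bu v_def scaleR_2)
  qed
  then have "(Z has_vector_derivative op_G j A B (Z t)) (at t)" for t
    unfolding Z_def[abs_def] by (auto intro!: has_vector_derivative_Pair V has_vector_derivative_add u jQ)
  from C0_group_Cauchy_unique[OF gen Zdom this] have "Z t = T t (Z 0)" for t .
  moreover have "T t 0 = 0" for t
    using C0_groupD(1)[of T t] gen by (auto simp: generates_C0_group_def intro: linear_0 bounded_linear.linear)
  ultimately have "Z t = 0" for t
    by (simp add: Z_def V Q 0 j.zero flip: zero_prod_def)
  \<comment> \<open>The first component suffices: its derivative is \<open>v\<close>, the solution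
    regarded as a curve in \<open>Y\<close>.\<close>
  then have "V = (\<lambda>t. 0)" by (auto simp: Z_def zero_prod_def)
  then have "v t = 0"
    using vector_derivative_unique_at[OF V(2)[of t], of 0] by simp
  then show ?thesis using jv[of t] by (simp add: j.zero)
qed

lemma classical_solution_unique:
  assumes "classical_solution domA A domB B x y u1" and "classical_solution domA A domB B x y u2"
  shows "u1 = u2"
proof
  fix t
  have "classical_solution domA A domB B 0 0 (\<lambda>t. u1 t - u2 t)"
  proof -
    obtain u1' u1'' where 1: "\<forall>t. (u1 has_vector_derivative u1' t) (at t)"
      "\<forall>t. (u1' has_vector_derivative u1'' t) (at t)"
      "continuous_on UNIV u1''" "\<forall>t. u1 t \<in> domA \<and> u1' t \<in> domB" "continuous_on UNIV (\<lambda>t. A (u1 t))"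
      "\<forall>t. u1'' t + 2 *\<^sub>R B (u1' t) = A (u1 t)" "u1 0 = x" "u1' 0 = y"
      using assms(1) unfolding classical_solution_iff by blast
    obtain u2' u2'' where 2: "\<forall>t. (u2 has_vector_derivative u2' t) (at t)"
      "\<forall>t. (u2' has_vector_derivative u2'' t) (at t)"
      "continuous_on UNIV u2''" "\<forall>t. u2 t \<in> domA \<and> u2' t \<in> domB" "continuous_on UNIV (\<lambda>t. A (u2 t))"
      "\<forall>t. u2'' t + 2 *\<^sub>R B (u2' t) = A (u2 t)" "u2 0 = x" "u2' 0 = y"
      using assms(2) unfolding classical_solution_iff by blast
    have Adiff: "A (u1 t - u2 t) = A (u1 t) - A (u2 t)" and Bdiff: "B (u1' t - u2' t) = B (u1' t) - B (u2' t)" for t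
      using 1(4) 2(4) by (simp_all add: A_lin B_lin)
    show ?thesis
      unfolding classical_solution_iff
    proof (rule exI[of _ "\<lambda>t. u1' t - u2' t"], rule exI[of _ "\<lambda>t. u1'' t - u2'' t"], intro conjI allI)
      show "continuous_on UNIV (\<lambda>t. u1'' t - u2'' t)" by (intro continuous_on_diff 1 2)
      show "continuous_on UNIV (\<lambda>t. A (u1 t - u2 t))" unfolding Adiff by (intro continuous_on_diff 1 2)
      show "u1'' t - u2'' t + 2 *\<^sub>R B (u1' t - u2' t) = A (u1 t - u2 t)" for t
        unfolding Adiff Bdiff 1(6)[rule_format, symmetric] 2(6)[rule_format, symmetric]
        by (simp add: scaleR_diff_right)
      show "u1 t - u2 t \<in> domA" "u1' t - u2' t \<in> domB" for t
        using 1(4) 2(4) by (simp_all add: subspace_diff A_lin(1) B_lin(1))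
    qed (use 1 2 in \<open>auto intro: has_vector_derivative_diff\<close>)
  qed
  from classical_solution_zero[OF this, of t] show "u1 t = u2 t" by simp
qed

end

theorem theorem3p6:
  fixes A B :: "'x::complex_banach \<Rightarrow> 'x" and domA domB :: "'x set"
    and j :: "'y::complex_banach \<Rightarrow> 'x"
    and T :: "real \<Rightarrow> 'y \<times> 'x \<Rightarrow> 'y \<times> 'x"
    and x y :: 'x
  assumes "closed_linear_operator domA A"
    and "closed_linear_operator domB B"
    and "resolvent_set domB B \<noteq> {}"
    and "continuous_embedding j"
    and "domA \<subseteq> dom_square domB B \<inter> range j"
    and "B ` domA \<subseteq> range j" and "range j \<subseteq> domB"
    and "generates_C0_group (dom_G j domA) (op_G j A B) T"
    and "x \<in> domA" and "y \<in> range j"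
  shows "(\<exists>!u. classical_solution domA A domB B x y u) \<and>
    classical_solution domA A domB B x y
      (\<lambda>t. j (block11 (T t) (inv j x) + block12 (T t) (y + B x)))"
proof -
  interpret second_order_problem A B domA domB j T
    by unfold_locales (use assms in auto)
  have "C0_group T" using gen by (simp add: generates_C0_group_def)
  then interpret T: bounded_linear "T t" for t by (rule C0_groupD(1))
  \<comment> \<open>Splitting \<open>(v, w)\<close> into \<open>(v, 0)\<close> and
    \<open>(0, w)\<close> rewrites the first component of the orbit in block form.\<close>
  have "fst (T t (v, w)) = block11 (T t) v + block12 (T t) w" for t v w
    using T.add[of t "(v, 0)" "(0, w)"] by (simp add: block11_def block12_def)
  then show ?thesis
    using classical_solution_orbit[OF assms(9,10)] classical_solution_unique by auto
qed

end
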